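(* Let $d\ge 1$ be an integer, let $T>0$ and let $\varepsilon\in[0,1]$. The random variable $\ell^T(\omega^n_\varepsilon)$ converges in probability to $\varepsilon$ as $n\to+\infty$; that is, for every $\delta>0$, $$\lim_{n\to+\infty}\mathbb{P}\left(\left|\ell^T(\omega^n_\varepsilon)-\varepsilon\right|\ge\delta\right)=0.$$
   Context: Let $M=\mathbb{T}^d=\mathbb{R}^d/\mathbb{Z}^d$ be the flat torus and let $\Gamma$ be the set of its unit-speed geodesics, i.e. curves $\gamma(t)=x+tv \bmod \mathbb{Z}^d$ with $x\in\mathbb{R}^d$, $v\in\mathbb{R}^d$, $|v|=1$ (Euclidean norm). For $T>0$, a measurable set $\omega\subset M$ and $\gamma\in\Gamma$, put $$m^T_\gamma(\omega)=\frac1T\int_0^T \mathbf{1}_\omega(\gamma(t))\,dt,\qquad \ell^T(\omega)=\inf_{\gamma\in\Gamma}m^T_\gamma(\omega).$$ Random checkerboard: for an integer $n\ge1$, divide $[0,1]^d$ (viewed in $M$, indices taken modulo $n$) into the $n^d$ closed cells $c_{i_1,\dots,i_d}=\left[\frac{i_1-1}{n},\frac{i_1}{n}\right]\times\dots\times\left[\frac{i_d-1}{n},\frac{i_d}{n}\right]$, $1\le i_1,\dots,i_d\le n$. Let $(X_{i_1,\dots,i_d})$ be $n^d$ independent Bernoulli random variables with parameter $\varepsilon$. Then $\omega^n_\varepsilon$ is the union of all cells $c_{i_1,\dots,i_d}$ with $X_{i_1,\dots,i_d}=1$. *)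

theory Defs
  imports "HOL-Probability.Probability"
begin

definition lattice_rel :: "real ^ 'd \<Rightarrow> real ^ 'd \<Rightarrow> bool"
  where "lattice_rel x y \<longleftrightarrow> (\<forall>k. x $ k - y $ k \<in> \<int>)"

lemma equivp_lattice_rel: "equivp (lattice_rel :: real ^ 'd \<Rightarrow> real ^ 'd \<Rightarrow> bool)"
proof (rule equivpI)
  show "reflp (lattice_rel :: real ^ 'd \<Rightarrow> _)"
    by (simp add: reflp_def lattice_rel_def)
  show "symp (lattice_rel :: real ^ 'd \<Rightarrow> _)"
  proof (rule sympI)
    fix x y :: "real ^ 'd"
    assume xy: "lattice_rel x y"
    have "y $ k - x $ k \<in> \<int>" for k
      using Ints_minus[of "x $ k - y $ k"] xy by (simp add: lattice_rel_def)
    then show "lattice_rel y x"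
      by (simp add: lattice_rel_def)
  qed
  show "transp (lattice_rel :: real ^ 'd \<Rightarrow> _)"
  proof (rule transpI)
    fix x y z :: "real ^ 'd"
    assume xy: "lattice_rel x y" and yz: "lattice_rel y z"
    have "x $ k - z $ k \<in> \<int>" for k
      using Ints_add[of "x $ k - y $ k" "y $ k - z $ k"] xy yz
      by (simp add: lattice_rel_def)
    then show "lattice_rel x z"
      by (simp add: lattice_rel_def)
  qed
qed

text \<open>The torus of dimension \<open>CARD('d)\<close>; \<open>abs_torus\<close> is the projection from \<open>real ^ 'd\<close>.\<close>

quotient_type 'd torus = "real ^ ('d :: finite)" / lattice_rel
  by (rule equivp_lattice_rel)

definition geodesics :: "(real \<Rightarrow> 'd :: finite torus) set"
  where "geodesics = {\<lambda>t. abs_torus (x + t *\<^sub>R v) | x v. norm v = 1}"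

text \<open>The average is meaningful when \<open>\<gamma> -` \<omega>\<close> is Borel, as it is for finite unions of closed
  cells; the Bochner integral of a non-measurable function is 0 by convention.\<close>

definition time_average :: "real \<Rightarrow> (real \<Rightarrow> 'd :: finite torus) \<Rightarrow> 'd torus set \<Rightarrow> real"
  where "time_average T \<gamma> \<omega> = 1 / T * (LINT t:{0..T}|lborel. indicator \<omega> (\<gamma> t))"

definition ell :: "real \<Rightarrow> 'd :: finite torus set \<Rightarrow> real"
  where "ell T \<omega> = (INF \<gamma>\<in>geodesics. time_average T \<gamma> \<omega>)"

definition cell_indices :: "nat \<Rightarrow> ('d :: finite \<Rightarrow> nat) set"
  where "cell_indices n = {i. \<forall>k. 1 \<le> i k \<and> i k \<le> n}"

definition cell :: "nat \<Rightarrow> ('d :: finite \<Rightarrow> nat) \<Rightarrow> 'd torus set"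
  where "cell n i = abs_torus `
    cbox (\<chi> k. (real (i k) - 1) / real n) (\<chi> k. real (i k) / real n)"

definition checkerboard :: "nat \<Rightarrow> (('d :: finite \<Rightarrow> nat) \<Rightarrow> bool) \<Rightarrow> 'd torus set"
  where "checkerboard n c = (\<Union>i\<in>{i \<in> cell_indices n. c i}. cell n i)"

end

theory Submission
  imports Defs "HOL-Real_Asymp.Real_Asymp"
begin

text \<open>
Along a geodesic \<open>x + t v\<close> that does not run inside a wall between cells, the time average of the
checkerboard is a weighted sum of the independent Bernoulli variables, the weight of a cell being
the proportion of time spent in it. The weights add up to 1, so the mean is \<open>\<epsilon>\<close>. Some coordinate
moves at speed at least \<open>1 / d\<close>, so each weight is \<open>O(1 / n)\<close> (\<open>visit_cell_le\<close>), and by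
Hoeffding's inequality the sum deviates from \<open>\<epsilon>\<close> by \<open>\<delta> / 2\<close> with probability at most
\<open>2 exp (- c n)\<close> (\<open>weighted_bernoulli_deviation\<close>).

To treat all geodesics at once, it suffices to find a net of polynomially many geodesics such that
every geodesic is in the same cell as some member of the net except during a time \<open>O(1 / n)\<close>
(\<open>exists_polynomial_net\<close>): the union bound then costs only a polynomial factor. The cell is
determined by the step functions \<open>\<lfloor>n (x\<^sub>k + t v\<^sub>k)\<rfloor>\<close> of the coordinates, so such a
net is found one coordinate at a time. A coordinate that is not too slow is described by rounding
\<open>x\<^sub>k\<close> and \<open>v\<^sub>k\<close>; a very slow one crosses at most one wall, and is described by this wall and a
rounded crossing time (\<open>line_code_eq_imp_close\<close>). The same code in all coordinates makes the
weights close in total variation (\<open>geodesic_code_eq_imp_visit_le\<close>).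

Geodesics inside walls are handled by attributing each wall to one of its two sides. This makes
cells half-open and time averages smaller, so the lower bound persists for every geodesic
(\<open>visit_le_time_average\<close>), while the upper bound on the infimum needs only one geodesic, which may
be chosen to cross walls transversally (\<open>exists_line_off_walls\<close>).\<close>

section \<open>The cells met by a line\<close>

text \<open>The cell that contains \<open>y\<close> when the cells are made half-open: they then partition the torus, so
exactly one cell is visited at each time.\<close>

definition cell_of :: "nat \<Rightarrow> real ^ 'd \<Rightarrow> ('d :: finite \<Rightarrow> nat)"
  where "cell_of n y = (\<lambda>k. nat (\<lfloor>real n * y $ k\<rfloor> mod int n) + 1)"

lemma finite_cell_indices: "finite (cell_indices n :: ('d :: finite \<Rightarrow> nat) set)"
proof -
  have "cell_indices n = (PiE UNIV (\<lambda>_. {1..n}) :: ('d \<Rightarrow> nat) set)"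
    by (auto simp: cell_indices_def PiE_def Pi_def)
  then show ?thesis by (simp add: finite_PiE)
qed

lemma abs_torus_eq_iff: "abs_torus x = abs_torus y \<longleftrightarrow> (\<forall>k. x $ k - y $ k \<in> \<int>)"
  using Quotient3_rel[OF Quotient3_torus, of x y] equivp_reflp[OF equivp_lattice_rel]
  by (auto simp: lattice_rel_def)

lemma mem_cell_iff:
  "abs_torus y \<in> cell n i \<longleftrightarrow>
    (\<forall>k. \<exists>m::int. (real (i k) - 1) / real n \<le> y $ k - m \<and> y $ k - m \<le> real (i k) / real n)"
  (is "?L \<longleftrightarrow> ?R")
proof
  assume ?L
  then obtain z where z: "abs_torus y = abs_torus z"
    "z \<in> cbox (\<chi> k. (real (i k) - 1) / real n) (\<chi> k. real (i k) / real n)"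
    by (auto simp: cell_def)
  show ?R
  proof
    fix k
    from z(1) obtain m where "y $ k - z $ k = of_int m"
      unfolding abs_torus_eq_iff by (meson Ints_cases)
    then have "z $ k = y $ k - of_int m" by simp
    with z(2) show "\<exists>m::int. (real (i k) - 1) / real n \<le> y $ k - m \<and> y $ k - m \<le> real (i k) / real n"
      by (intro exI[of _ m]) (auto simp: mem_box_cart dest!: spec[of _ k])
  qed
next
  assume ?R
  then obtain m :: "'a \<Rightarrow> int" where m: "\<And>k. (real (i k) - 1) / real n \<le> y $ k - m k"
     "\<And>k. y $ k - m k \<le> real (i k) / real n" by metis
  have "abs_torus y = abs_torus (\<chi> k. y $ k - m k)" by (simp add: abs_torus_eq_iff)
  moreover have "(\<chi> k. y $ k - m k) \<in> cbox (\<chi> k. (real (i k) - 1) / real n) (\<chi> k. real (i k) / real n)"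
    using m by (simp add: mem_box_cart)
  ultimately show ?L unfolding cell_def by blast
qed

lemma cell_of_in_cell_indices: "n \<ge> 1 \<Longrightarrow> cell_of n y \<in> cell_indices n"
  unfolding cell_of_def cell_indices_def by (auto simp: Suc_le_eq nat_less_iff)

lemma abs_torus_in_cell_of:
  assumes "n \<ge> 1" shows "abs_torus y \<in> cell n (cell_of n y)"
  unfolding mem_cell_iff
proof
  fix k
  let ?q = "\<lfloor>real n * y $ k\<rfloor>"
  have r: "real (cell_of n y k) - 1 = real_of_int (?q mod int n)"
    using assms by (simp add: cell_of_def)
  have "?q = int n * (?q div int n) + ?q mod int n" by simp
  then have q: "real_of_int ?q = real n * real_of_int (?q div int n) + real_of_int (?q mod int n)"
    by (metis of_int_add of_int_mult of_int_of_nat_eq)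
  have "real_of_int ?q \<le> real n * y $ k" "real n * y $ k \<le> real_of_int ?q + 1" by linarith+
  with q r assms show "\<exists>m::int. (real (cell_of n y k) - 1) / real n \<le> y $ k - m \<and>
      y $ k - m \<le> real (cell_of n y k) / real n"
    by (intro exI[of _ "?q div int n"]) (simp add: field_simps)
qed

text \<open>The closed cells overlap only on the walls, where some coordinate of \<open>n y\<close> is an integer.\<close>

lemma cell_of_unique:
  assumes "n \<ge> 1" "i \<in> cell_indices n" "abs_torus y \<in> cell n i" "\<And>k. real n * y $ k \<notin> \<int>"
  shows "i = cell_of n y"
proof
  fix k
  from assms(3) obtain m :: int where m: "(real (i k) - 1) / real n \<le> y $ k - m"
     "y $ k - m \<le> real (i k) / real n" unfolding mem_cell_iff by blast
  define j where "j = int n * m + int (i k) - 1"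
  have i: "1 \<le> i k" "i k \<le> n" using assms(2) by (auto simp: cell_indices_def)
  from m assms(1) have "of_int j \<le> real n * y $ k" "real n * y $ k \<le> of_int (j + 1)"
    by (simp_all add: j_def field_simps)
  moreover have "real n * y $ k \<noteq> of_int (j + 1)" using assms(4)[of k] by (metis Ints_of_int)
  ultimately have "\<lfloor>real n * y $ k\<rfloor> = j" by (simp add: floor_eq_iff)
  moreover have "j mod int n = int (i k) - 1"
  proof -
    have "j = (int (i k) - 1) + int n * m" by (simp add: j_def)
    then have "j mod int n = (int (i k) - 1) mod int n" by simp
    then show ?thesis using i by simp
  qed
  ultimately show "i k = cell_of n y k" using i by (simp add: cell_of_def)
qed

lemma measurable_cell_of:
  "{t \<in> {0..T}. cell_of n (x + t *\<^sub>R v) \<in> A} \<in> sets borel"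
proof (cases "n = 0")
  case True
  then have "{t \<in> {0..T}. cell_of n (x + t *\<^sub>R v) \<in> A} = (if (\<lambda>_. 1) \<in> A then {0..T} else {})"
    by (auto simp: cell_of_def)
  then show ?thesis by simp
next
  case False
  then have n: "n \<ge> 1" by simp
  have m: "{t. cell_of n (x + t *\<^sub>R v) = i} \<in> sets borel" for i
  proof -
    have "{t. nat (\<lfloor>real n * (x $ k + t * v $ k)\<rfloor> mod int n) + 1 = i k} \<in> sets borel" for k
    proof -
      have "(\<lambda>t. \<lfloor>real n * (x $ k + t * v $ k)\<rfloor>) \<in> borel \<rightarrow>\<^sub>M count_space UNIV"
        by measurable
      from measurable_sets[OF this, of "{q. nat (q mod int n) + 1 = i k}"] show ?thesis
        by (simp add: vimage_def)
    qed
    then have "(\<Inter>k\<in>UNIV. {t. nat (\<lfloor>real n * (x $ k + t * v $ k)\<rfloor> mod int n) + 1 = i k}) \<in> sets borel"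
      by (intro sets.finite_INT) auto
    moreover have "(\<Inter>k\<in>UNIV. {t. nat (\<lfloor>real n * (x $ k + t * v $ k)\<rfloor> mod int n) + 1 = i k}) =
        {t. cell_of n (x + t *\<^sub>R v) = i}"
      by (auto simp: cell_of_def fun_eq_iff)
    ultimately show ?thesis by (simp only:)
  qed
  have "{t \<in> {0..T}. cell_of n (x + t *\<^sub>R v) \<in> A} =
     {0..T} \<inter> (\<Union>i\<in>cell_indices n \<inter> A. {t. cell_of n (x + t *\<^sub>R v) = i})"
    using cell_of_in_cell_indices[OF n] by auto
  also have "\<dots> \<in> sets borel"
    using finite_cell_indices m by (intro sets.Int sets.finite_UN) auto
  finally show ?thesis .
qed

lemma measurable_time_in_checkerboard:
  "{t \<in> {0..T}. abs_torus (x + t *\<^sub>R v) \<in> checkerboard n c} \<in> sets borel"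
proof -
  have cell: "{t. abs_torus (x + t *\<^sub>R v) \<in> cell n i} \<in> sets borel" for i
  proof -
    have "closed {t. (real (i k) - 1) / real n \<le> x $ k + t * v $ k - of_int m \<and>
        x $ k + t * v $ k - of_int m \<le> real (i k) / real n}" for k m
      by (intro closed_Collect_conj closed_Collect_le continuous_intros)
    then have "(\<Inter>k\<in>UNIV. \<Union>m::int. {t. (real (i k) - 1) / real n \<le> x $ k + t * v $ k - of_int m \<and>
        x $ k + t * v $ k - of_int m \<le> real (i k) / real n}) \<in> sets borel"
      by (intro sets.finite_INT sets.countable_UN'' borel_closed) auto
    moreover have "(\<Inter>k\<in>UNIV. \<Union>m::int. {t. (real (i k) - 1) / real n \<le> x $ k + t * v $ k - of_int m \<and>
        x $ k + t * v $ k - of_int m \<le> real (i k) / real n}) = {t. abs_torus (x + t *\<^sub>R v) \<in> cell n i}"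
      by (auto simp: mem_cell_iff)
    ultimately show ?thesis by (simp only:)
  qed
  have "{t \<in> {0..T}. abs_torus (x + t *\<^sub>R v) \<in> checkerboard n c} =
     {0..T} \<inter> (\<Union>i\<in>{i \<in> cell_indices n. c i}. {t. abs_torus (x + t *\<^sub>R v) \<in> cell n i})"
    by (auto simp: checkerboard_def)
  also have "\<dots> \<in> sets borel"
    using finite_cell_indices[of n] cell by (intro sets.Int sets.finite_UN) auto
  finally show ?thesis .
qed

lemma time_average_eq_measure:
  "time_average T (\<lambda>t. abs_torus (x + t *\<^sub>R v)) (checkerboard n c) =
    measure lborel {t \<in> {0..T}. abs_torus (x + t *\<^sub>R v) \<in> checkerboard n c} / T"
proof -
  let ?B = "{t \<in> {0..T}. abs_torus (x + t *\<^sub>R v) \<in> checkerboard n c}"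
  have "(LINT t:{0..T}|lborel. indicator (checkerboard n c) (abs_torus (x + t *\<^sub>R v)) :: real)
      = (LINT t|lborel. indicator ?B t)"
    unfolding set_lebesgue_integral_def
    by (intro Bochner_Integration.integral_cong) (auto simp: indicator_def)
  also have "\<dots> = measure lborel ?B" using measurable_time_in_checkerboard by simp
  finally show ?thesis by (simp add: time_average_def)
qed

text \<open>The proportion of \<open>[0, T]\<close> that the line spends in the half-open cells of \<open>A\<close>. For a random \<open>A\<close>
this is a weighted sum of independent Bernoulli variables, which the time average over the closed
cells is not along a wall.\<close>

definition visit :: "real \<Rightarrow> nat \<Rightarrow> real ^ 'd \<Rightarrow> real ^ 'd \<Rightarrow> ('d :: finite \<Rightarrow> nat) set \<Rightarrow> real"
  where "visit T n x v A = measure lborel {t \<in> {0..T}. cell_of n (x + t *\<^sub>R v) \<in> A} / T"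

lemma fmeasurable_Icc: "{a..b} \<in> fmeasurable lborel" for a b :: real
  using fmeasurable_cbox[of a b] by (simp add: cbox_interval)

lemma fmeasurable_subset_Icc:
  "A \<in> sets borel \<Longrightarrow> A \<subseteq> {a..b} \<Longrightarrow> A \<in> fmeasurable lborel" for a b :: real
  by (rule fmeasurableI2[of "{a..b}"]) (auto simp: fmeasurable_Icc)

text \<open>Along a wall, a closed checkerboard shows the union of all adjacent cells. Since the half-open cell
is contained in the closed one, this can only increase the time average, and no geodesic needs an
exceptional treatment in the lower bound of the infimum.\<close>

lemma visit_le_time_average:
  assumes "T > 0" "n \<ge> 1"
  shows "visit T n x v {i. c i} \<le> time_average T (\<lambda>t. abs_torus (x + t *\<^sub>R v)) (checkerboard n c)"
proof -
  have "measure lborel {t \<in> {0..T}. cell_of n (x + t *\<^sub>R v) \<in> {i. c i}} \<le>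
     measure lborel {t \<in> {0..T}. abs_torus (x + t *\<^sub>R v) \<in> checkerboard n c}"
  proof (rule measure_mono_fmeasurable)
    show "{t \<in> {0..T}. cell_of n (x + t *\<^sub>R v) \<in> {i. c i}} \<subseteq>
        {t \<in> {0..T}. abs_torus (x + t *\<^sub>R v) \<in> checkerboard n c}"
      using cell_of_in_cell_indices[OF assms(2)] abs_torus_in_cell_of[OF assms(2)]
      by (auto simp: checkerboard_def)
    show "{t \<in> {0..T}. abs_torus (x + t *\<^sub>R v) \<in> checkerboard n c} \<in> fmeasurable lborel"
      by (rule fmeasurable_subset_Icc[OF measurable_time_in_checkerboard]) auto
  qed (simp only: sets_lborel measurable_cell_of)
  then show ?thesis using assms(1) by (simp add: visit_def time_average_eq_measure divide_right_mono)
qed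

lemma time_average_eq_visit:
  assumes "n \<ge> 1" and countable: "countable {t. \<exists>k. real n * (x + t *\<^sub>R v) $ k \<in> \<int>}"
  shows "time_average T (\<lambda>t. abs_torus (x + t *\<^sub>R v)) (checkerboard n c) = visit T n x v {i. c i}"
proof -
  have "AE t in lborel. t \<notin> {t. \<exists>k. real n * (x + t *\<^sub>R v) $ k \<in> \<int>}"
    using countable_imp_null_set_lborel[OF countable] by (rule AE_not_in)
  then have "AE t in lborel. t \<in> {t \<in> {0..T}. abs_torus (x + t *\<^sub>R v) \<in> checkerboard n c} \<longleftrightarrow>
     t \<in> {t \<in> {0..T}. cell_of n (x + t *\<^sub>R v) \<in> {i. c i}}"
  proof eventually_elim
    case (elim t)
    then have "real n * (x + t *\<^sub>R v) $ k \<notin> \<int>" for k by blast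
    from cell_of_unique[OF assms(1) _ _ this] cell_of_in_cell_indices[OF assms(1)]
      abs_torus_in_cell_of[OF assms(1)]
    show ?case by (auto simp: checkerboard_def)
  qed
  then have "measure lborel {t \<in> {0..T}. abs_torus (x + t *\<^sub>R v) \<in> checkerboard n c} =
     measure lborel {t \<in> {0..T}. cell_of n (x + t *\<^sub>R v) \<in> {i. c i}}"
    by (rule measure_eq_AE) (simp_all only: sets_lborel measurable_cell_of measurable_time_in_checkerboard)
  then show ?thesis by (simp add: time_average_eq_measure visit_def)
qed

section \<open>A polynomial encoding of one-dimensional motions\<close>

text \<open>A code with polynomially many values that determines the step function
\<open>t \<mapsto> \<lfloor>n (x + t v)\<rfloor>\<close> on \<open>[0, T]\<close> up to a set of times of measure \<open>O(1 / n)\<close>.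
Rounding \<open>x\<close> and \<open>v\<close> is not enough when \<open>v\<close> is close to 0, as the time at which a wall is crossed
is then not a Lipschitz function of \<open>(x, v)\<close>. But a motion with \<open>\<bar>v\<bar> \<le> 1 / n\<^sup>2\<close> crosses at most one
wall as soon as \<open>n > T\<close>; its step function is known from the initial and final values and the
crossing time, which is rounded here to a multiple of \<open>T / n\<close>.\<close>

definition line_code :: "real \<Rightarrow> nat \<Rightarrow> real \<Rightarrow> real \<Rightarrow> bool \<times> int \<times> int \<times> int"
  where "line_code T n x v =
    (if \<bar>v\<bar> > 1 / real n ^ 2 then (True, \<lfloor>real n ^ 4 * x\<rfloor>, \<lfloor>real n ^ 4 * v\<rfloor>, 0)
     else let a = \<lfloor>real n * x\<rfloor>; b = \<lfloor>real n * (x + T * v)\<rfloor>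
       in (False, a, b, if a = b then 0 else \<lfloor>real n * ((of_int (max a b) / real n - x) / v) / T\<rfloor>))"

lemma affine_between: "0 \<le> t \<Longrightarrow> t \<le> T \<Longrightarrow> min a (a + T * v) \<le> a + t * v \<and> a + t * v \<le> max a (a + T * v)"
  for a t v T :: real
  by (cases "v \<ge> 0")
    (auto simp: min_le_iff_disj le_max_iff_disj mult_right_mono mult_right_mono_neg
      zero_le_mult_iff mult_le_0_iff)

lemma slow_line_adjacent:
  assumes "n \<ge> 1" "T > 0" "real n > T" "\<bar>v\<bar> \<le> 1 / real n ^ 2"
  shows "\<bar>\<lfloor>real n * (x + T * v)\<rfloor> - \<lfloor>real n * x\<rfloor>\<bar> \<le> 1"
proof -
  have "\<bar>real n * (T * v)\<bar> = real n * T * \<bar>v\<bar>" using assms by (simp add: abs_mult)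
  also have "\<dots> \<le> real n * T * (1 / real n ^ 2)" using assms by (intro mult_left_mono) auto
  also have "\<dots> = T / real n" using assms by (simp add: power2_eq_square)
  also have "\<dots> < 1" using assms by simp
  finally have "\<bar>real n * (T * v)\<bar> < 1" .
  then have "\<bar>real n * (x + T * v) - real n * x\<bar> < 1" by (simp add: algebra_simps)
  then show ?thesis by linarith
qed

text \<open>The larger of two adjacent values of \<open>\<lfloor>n (x + t v)\<rfloor>\<close> is the index of the wall between
them, for an increasing as for a decreasing motion; this is why the crossing time \<open>s\<close> has one formula
in both cases.\<close>

lemma slow_line_crossing:
  fixes x v T :: real
  assumes "n \<ge> 1" "T > 0" "real n > T" "\<bar>v\<bar> \<le> 1 / real n ^ 2"
  defines "a \<equiv> \<lfloor>real n * x\<rfloor>" and "b \<equiv> \<lfloor>real n * (x + T * v)\<rfloor>"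
  defines "s \<equiv> (of_int (max a b) / real n - x) / v"
  assumes "a \<noteq> b"
  shows "0 \<le> s" "s \<le> T"
    "0 \<le> t \<Longrightarrow> t < s \<Longrightarrow> \<lfloor>real n * (x + t * v)\<rfloor> = a"
    "s < t \<Longrightarrow> t \<le> T \<Longrightarrow> \<lfloor>real n * (x + t * v)\<rfloor> = b"
proof -
  have ab: "\<bar>b - a\<bar> \<le> 1" unfolding a_def b_def by (rule slow_line_adjacent) fact+
  have n: "real n > 0" using assms by simp
  have fa: "of_int a \<le> real n * x" "real n * x < of_int a + 1" unfolding a_def by linarith+
  have fb: "of_int b \<le> real n * (x + T * v)" "real n * (x + T * v) < of_int b + 1" unfolding b_def by linarith+
  from \<open>a \<noteq> b\<close> have "v \<noteq> 0" unfolding a_def b_def by auto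
  define g where "g = (\<lambda>t. real n * (x + t * v))"
  have g: "g t = real n * x + t * (real n * v)" for t by (simp add: g_def algebra_simps)
  have gs: "g s = of_int (max a b)" using \<open>v \<noteq> 0\<close> n by (simp add: g_def s_def)
  have "0 \<le> s \<and> s \<le> T \<and> (0 \<le> t \<and> t < s \<longrightarrow> \<lfloor>g t\<rfloor> = a) \<and> (s < t \<and> t \<le> T \<longrightarrow> \<lfloor>g t\<rfloor> = b)"
  proof (cases "v > 0")
    case True
    then have mono: "g u < g w \<longleftrightarrow> u < w" for u w using n by (simp add: g)
    then have mono': "g u \<le> g w \<longleftrightarrow> u \<le> w" for u w by (meson leD le_less_linear)
    have "g 0 \<le> g T" using mono'[of 0 T] assms by simp
    then have "a \<le> b" unfolding a_def b_def g_def by (simp add: floor_mono)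
    with ab \<open>a \<noteq> b\<close> have b: "b = a + 1" by linarith
    have 1: "g 0 < g s" "g s \<le> g T" using fa fb gs b by (simp_all add: g_def)
    have 2: "\<lfloor>g t\<rfloor> = a" if "0 \<le> t" "t < s"
      using mono[of t s] mono'[of 0 t] that fa gs b
      by (simp add: floor_eq_iff) (simp add: g_def)
    have 3: "\<lfloor>g t\<rfloor> = b" if "s < t" "t \<le> T"
      using mono[of s t] mono'[of t T] that fb gs b
      by (simp add: floor_eq_iff) (simp add: g_def)
    from 1 2 3 show ?thesis by (auto simp: mono mono')
  next
    case False
    with \<open>v \<noteq> 0\<close> have "v < 0" by simp
    then have mono: "g u < g w \<longleftrightarrow> w < u" for u w using n by (simp add: g mult_less_0_iff)
    then have mono': "g u \<le> g w \<longleftrightarrow> w \<le> u" for u w by (meson leD le_less_linear)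
    have "g T \<le> g 0" using mono'[of T 0] assms by simp
    then have "b \<le> a" unfolding a_def b_def g_def by (simp add: floor_mono)
    with ab \<open>a \<noteq> b\<close> have b: "a = b + 1" by linarith
    have 1: "g s \<le> g 0" "g T < g s" using fa fb gs b by (simp_all add: g_def)
    have 2: "\<lfloor>g t\<rfloor> = a" if "0 \<le> t" "t < s"
      using mono[of s t] mono'[of t 0] that fa gs b
      by (simp add: floor_eq_iff) (simp add: g_def)
    have 3: "\<lfloor>g t\<rfloor> = b" if "s < t" "t \<le> T"
      using mono[of t s] mono'[of T t] that fb gs b
      by (simp add: floor_eq_iff) (simp add: g_def)
    from 1 2 3 show ?thesis by (auto simp: mono mono')
  qed
  then show "0 \<le> s" "s \<le> T"
    "0 \<le> t \<Longrightarrow> t < s \<Longrightarrow> \<lfloor>real n * (x + t * v)\<rfloor> = a"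
    "s < t \<Longrightarrow> t \<le> T \<Longrightarrow> \<lfloor>real n * (x + t * v)\<rfloor> = b"
    by (auto simp: g_def)
qed

lemma slow_line_constant:
  assumes "n \<ge> 1" "\<lfloor>real n * (x + T * v)\<rfloor> = \<lfloor>real n * x\<rfloor>" "0 \<le> t" "t \<le> T"
  shows "\<lfloor>real n * (x + t * v)\<rfloor> = \<lfloor>real n * x\<rfloor>"
proof -
  have "min (real n * x) (real n * (x + T * v)) \<le> real n * (x + t * v)"
    "real n * (x + t * v) \<le> max (real n * x) (real n * (x + T * v))"
    using affine_between[OF assms(3,4), of "real n * x" "real n * v"] by (simp_all add: algebra_simps)
  with assms(2) show ?thesis by (simp add: floor_eq_iff) linarith
qed

lemma floor_neq_imp_near_integer:
  fixes p q r :: real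
  assumes "\<lfloor>p\<rfloor> \<noteq> \<lfloor>q\<rfloor>" "\<bar>p - q\<bar> \<le> r"
  shows "\<exists>j::int. \<bar>p - of_int j\<bar> \<le> r"
proof (cases "\<lfloor>p\<rfloor> < \<lfloor>q\<rfloor>")
  case True
  then have "p \<le> of_int \<lfloor>q\<rfloor>" "of_int \<lfloor>q\<rfloor> \<le> q" by linarith+
  with assms show ?thesis by (intro exI[of _ "\<lfloor>q\<rfloor>"]) linarith
next
  case False
  then have "q \<le> of_int \<lfloor>p\<rfloor>" "of_int \<lfloor>p\<rfloor> \<le> p" using assms by linarith+
  with assms show ?thesis by (intro exI[of _ "\<lfloor>p\<rfloor>"]) linarith
qed

lemma floor_mult_eq_imp_close:
  fixes N x y :: real
  assumes "\<lfloor>N * x\<rfloor> = \<lfloor>N * y\<rfloor>" "N > 0" shows "\<bar>x - y\<bar> \<le> 1 / N"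
proof -
  have "N * \<bar>x - y\<bar> = \<bar>N * x - N * y\<bar>" using assms(2) by (simp add: right_diff_distrib[symmetric] abs_mult)
  also have "\<dots> \<le> 1" using assms(1) by linarith
  finally show ?thesis using assms(2) by (simp add: field_simps)
qed

lemma measure_UN_Icc_le:
  fixes c :: "'a \<Rightarrow> real"
  assumes "finite J" "r \<ge> 0"
  shows "measure lborel (\<Union>j\<in>J. {c j - r .. c j + r}) \<le> real (card J) * (2 * r)"
proof -
  have "measure lborel (\<Union>j\<in>J. {c j - r .. c j + r}) \<le> (\<Sum>j\<in>J. measure lborel {c j - r .. c j + r})"
    using assms by (intro measure_UNION_le) auto
  then show ?thesis using assms by simp
qed

lemma measurable_floor_disagreement:
  "{t \<in> {0..T}. \<lfloor>real n * (x + t * v)\<rfloor> \<noteq> \<lfloor>real n * (x' + t * v')\<rfloor>} \<in> sets borel"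
proof -
  have "Measurable.pred borel (\<lambda>t. \<lfloor>real n * (x + t * v)\<rfloor> \<noteq> \<lfloor>real n * (x' + t * v')\<rfloor>)"
    by measurable
  then have "{t. \<lfloor>real n * (x + t * v)\<rfloor> \<noteq> \<lfloor>real n * (x' + t * v')\<rfloor>} \<inter> {0..T} \<in> sets borel"
    by (intro sets.Int) (auto simp: pred_def)
  then show ?thesis by (simp add: Collect_conj_eq Int_commute)
qed

text \<open>In the fast regime, the two motions differ by \<open>O(n\<^sup>-\<^sup>3)\<close> after scaling by \<open>n\<close>, so they can be in
different cells only when the first one is that close to a wall. Each of the \<open>O(n)\<close> walls is
near for a time \<open>O(n\<^sup>-\<^sup>4 / \<bar>v\<bar>) \<le> O(n\<^sup>-\<^sup>2)\<close>, which makes \<open>O(1 / n)\<close> in total. In the slow regime they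
differ only between the two crossing times.\<close>

lemma line_code_eq_imp_close:
  assumes "n \<ge> 1" "T > 0" "real n > T" "0 \<le> x" "x \<le> 1" "\<bar>v\<bar> \<le> 1"
    and eq: "line_code T n x v = line_code T n x' v'"
  shows "measure lborel {t \<in> {0..T}. \<lfloor>real n * (x + t * v)\<rfloor> \<noteq> \<lfloor>real n * (x' + t * v')\<rfloor>}
    \<le> 10 * (1 + T)^2 / real n" (is "measure lborel ?D \<le> _")
proof -
  have n: "real n \<ge> 1" using assms by simp
  have T1: "T \<le> 10 * (1 + T)^2"
    using \<open>T > 0\<close> by (simp add: power2_eq_square algebra_simps add_nonneg_nonneg)
  show ?thesis
  proof (cases "\<bar>v\<bar> > 1 / real n ^ 2")
    case True
    from eq True have v': "\<bar>v'\<bar> > 1 / real n ^ 2"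
      by (auto simp: line_code_def Let_def split: if_splits)
    with eq True have "\<lfloor>real n ^ 4 * x\<rfloor> = \<lfloor>real n ^ 4 * x'\<rfloor>" "\<lfloor>real n ^ 4 * v\<rfloor> = \<lfloor>real n ^ 4 * v'\<rfloor>"
      by (auto simp: line_code_def)
    then have dx: "\<bar>x - x'\<bar> \<le> 1 / real n ^ 4" and dv: "\<bar>v - v'\<bar> \<le> 1 / real n ^ 4"
      using n by (auto intro!: floor_mult_eq_imp_close)
    define r where "r = (1 + T) / real n ^ 3"
    \<comment> \<open>The walls that can be near the line in time \<open>T\<close>: \<open>\<bar>n (x + t v)\<bar> \<le> n (1 + T)\<close>, and \<open>r \<le> n (1 + T)\<close>.\<close>
    define J where "J = {-\<lfloor>2 * real n * (1 + T)\<rfloor>..\<lfloor>2 * real n * (1 + T)\<rfloor>}"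
    \<comment> \<open>The scaled motion has speed at least \<open>n / n\<^sup>2\<close>, so it is within \<open>r\<close> of a given wall only for times within \<open>\<rho> = n r\<close> of the crossing.\<close>
    define \<rho> where "\<rho> = (1 + T) / real n ^ 2"
    have v0: "v \<noteq> 0" using True by auto
    have sub: "?D \<subseteq> (\<Union>j\<in>J. {(of_int j / real n - x) / v - \<rho> .. (of_int j / real n - x) / v + \<rho>})"
    proof
      fix t assume "t \<in> ?D"
      then have t: "0 \<le> t" "t \<le> T" "\<lfloor>real n * (x + t * v)\<rfloor> \<noteq> \<lfloor>real n * (x' + t * v')\<rfloor>" by auto
      have "\<bar>(x + t * v) - (x' + t * v')\<bar> \<le> \<bar>x - x'\<bar> + \<bar>t * (v - v')\<bar>"
        by (simp add: algebra_simps)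
      also have "\<bar>t * (v - v')\<bar> \<le> T * (1 / real n ^ 4)"
        using t dv \<open>T > 0\<close> by (simp only: abs_mult) (intro mult_mono, auto)
      finally have "\<bar>(x + t * v) - (x' + t * v')\<bar> \<le> (1 + T) / real n ^ 4"
        using dx by (simp add: add_divide_distrib)
      then have "real n * \<bar>(x + t * v) - (x' + t * v')\<bar> \<le> real n * ((1 + T) / real n ^ 4)"
        by (intro mult_left_mono) auto
      also have "\<dots> = r" using n by (simp add: r_def eval_nat_numeral field_simps)
      finally have "\<bar>real n * (x + t * v) - real n * (x' + t * v')\<bar> \<le> r"
        by (simp add: right_diff_distrib[symmetric] abs_mult)
      from floor_neq_imp_near_integer[OF t(3) this] obtain j :: int
        where j: "\<bar>real n * (x + t * v) - of_int j\<bar> \<le> r" by blast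
      have "\<bar>t * v\<bar> \<le> T * 1"
        using t \<open>\<bar>v\<bar> \<le> 1\<close> \<open>T > 0\<close> by (simp only: abs_mult) (intro mult_mono, auto)
      then have "\<bar>x + t * v\<bar> \<le> 1 + T" using assms by linarith
      then have "real n * \<bar>x + t * v\<bar> \<le> real n * (1 + T)" by (intro mult_left_mono) auto
      then have "\<bar>real n * (x + t * v)\<bar> \<le> real n * (1 + T)" by (simp add: abs_mult)
      moreover have "r \<le> real n * (1 + T)"
      proof -
        have "r \<le> (1 + T) / 1" unfolding r_def using n \<open>T > 0\<close> by (intro divide_left_mono) auto
        also have "\<dots> \<le> real n * (1 + T)" using n \<open>T > 0\<close> by simp
        finally show ?thesis .
      qed
      ultimately have "\<bar>of_int j\<bar> \<le> 2 * real n * (1 + T)" using j by linarith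
      then have "j \<in> J" unfolding J_def by simp linarith
      moreover have "\<bar>t - (of_int j / real n - x) / v\<bar> \<le> \<rho>"
      proof -
        have "t - (of_int j / real n - x) / v = (real n * (x + t * v) - of_int j) / (real n * v)"
          using v0 n by (simp add: field_simps)
        then have "\<bar>t - (of_int j / real n - x) / v\<bar> = \<bar>real n * (x + t * v) - of_int j\<bar> / (real n * \<bar>v\<bar>)"
          by (simp add: abs_mult)
        also have "\<dots> \<le> r / (real n * (1 / real n ^ 2))"
          using j True n v0 by (intro frac_le mult_left_mono) (auto simp: )
        also have "\<dots> = \<rho>" using n by (simp add: r_def \<rho>_def eval_nat_numeral field_simps)
        finally show ?thesis .
      qed
      ultimately show "t \<in> (\<Union>j\<in>J. {(of_int j / real n - x) / v - \<rho> .. (of_int j / real n - x) / v + \<rho>})"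
        by (intro UN_I[of j]) (auto simp: abs_le_iff)
    qed
    have \<rho>: "\<rho> \<ge> 0" using \<open>T > 0\<close> by (simp add: \<rho>_def)
    have "measure lborel ?D \<le>
        measure lborel (\<Union>j\<in>J. {(of_int j / real n - x) / v - \<rho> .. (of_int j / real n - x) / v + \<rho>})"
      using sub measurable_floor_disagreement
      by (intro measure_mono_fmeasurable fmeasurable.finite_UN fmeasurable_Icc) (simp_all add: J_def)
    also have "\<dots> \<le> real (card J) * (2 * \<rho>)"
      using \<rho> by (intro measure_UN_Icc_le) (auto simp: J_def)
    also have "\<dots> \<le> (5 * real n * (1 + T)) * (2 * \<rho>)"
    proof (intro mult_right_mono)
      have p: "1 \<le> real n * (1 + T)"
        using mult_mono[of 1 "real n" 1 "1 + T"] n \<open>T > 0\<close> by simp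
      then have "0 \<le> \<lfloor>2 * real n * (1 + T)\<rfloor>" by (simp add: mult.assoc) 
      then have "real (card J) = 2 * of_int \<lfloor>2 * real n * (1 + T)\<rfloor> + 1"
        by (simp add: J_def)
      also have "\<dots> \<le> 2 * (2 * real n * (1 + T)) + 1" by linarith
      also have "\<dots> \<le> 5 * real n * (1 + T)" using p by (simp add: algebra_simps)
      finally show "real (card J) \<le> 5 * real n * (1 + T)" .
    qed (use \<rho> in auto)
    also have "\<dots> = 10 * (1 + T)^2 / real n"
      using n by (simp add: \<rho>_def power2_eq_square field_simps)
    finally show ?thesis .
  next
    case False
    define a where "a = \<lfloor>real n * x\<rfloor>"
    define b where "b = \<lfloor>real n * (x + T * v)\<rfloor>"
    define s where "s = (of_int (max a b) / real n - x) / v"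
    define s' where "s' = (of_int (max a b) / real n - x') / v'"
    from eq False have v': "\<not> \<bar>v'\<bar> > 1 / real n ^ 2"
      by (auto simp: line_code_def Let_def split: if_splits)
    from eq False v' have a': "a = \<lfloor>real n * x'\<rfloor>" and b': "b = \<lfloor>real n * (x' + T * v')\<rfloor>"
      by (auto simp: line_code_def a_def b_def Let_def)
    show ?thesis
    proof (cases "a = b")
      case True
      then have "\<lfloor>real n * (x + T * v)\<rfloor> = \<lfloor>real n * x\<rfloor>" "\<lfloor>real n * (x' + T * v')\<rfloor> = \<lfloor>real n * x'\<rfloor>"
        by (simp_all only: a_def[symmetric] b_def[symmetric] a'[symmetric] b'[symmetric])
      from slow_line_constant[OF assms(1) this(1)] slow_line_constant[OF assms(1) this(2)]
      have "\<lfloor>real n * (x + t * v)\<rfloor> = a" "\<lfloor>real n * (x' + t * v')\<rfloor> = a" if "0 \<le> t" "t \<le> T" for t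
        using that by (simp_all only: a_def[symmetric] a'[symmetric])
      then have "?D = {}" by auto
      then have "measure lborel ?D = 0" by (metis measure_empty)
      then show ?thesis by simp
    next
      case ab: False
      have "line_code T n x v = (False, a, b, \<lfloor>real n * s / T\<rfloor>)"
        using False ab by (simp add: line_code_def Let_def s_def a_def b_def)
      moreover have "line_code T n x' v' = (False, a, b, \<lfloor>real n * s' / T\<rfloor>)"
        using v' ab unfolding s'_def by (simp add: line_code_def Let_def a' b')
      ultimately have "\<lfloor>(real n / T) * s\<rfloor> = \<lfloor>(real n / T) * s'\<rfloor>" using eq by simp
      then have ss: "\<bar>s - s'\<bar> \<le> T / real n"
        using floor_mult_eq_imp_close[of "real n / T" s s'] n \<open>T > 0\<close> by simp
      note c = slow_line_crossing[OF assms(1-3), of v x, folded a_def b_def, folded s_def]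
      note c' = slow_line_crossing[OF assms(1-3), of v' x', folded a' b', folded s'_def]
      have "?D \<subseteq> {min s s' .. max s s'}"
      proof
        fix t assume t: "t \<in> ?D"
        \<comment> \<open>Before both crossings both motions have the value \<open>a\<close>, after both crossings the value \<open>b\<close>.\<close>
        have "\<not> t < min s s'" using c(3)[of t] c'(3)[of t] False v' ab t by auto
        moreover have "\<not> t > max s s'" using c(4)[of t] c'(4)[of t] False v' ab t by auto
        ultimately show "t \<in> {min s s' .. max s s'}" by auto
      qed
      then have "measure lborel ?D \<le> measure lborel {min s s' .. max s s'}"
        using measurable_floor_disagreement by (intro measure_mono_fmeasurable fmeasurable_Icc) simp_all
      also have "\<dots> = \<bar>s - s'\<bar>" by auto
      also have "\<dots> \<le> 10 * (1 + T)^2 / real n"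
        using ss divide_right_mono[OF T1, of "real n"] by simp
      finally show ?thesis .
    qed
  qed
qed

lemma line_code_range:
  assumes "n \<ge> 1" "T > 0" "real n > T" "0 \<le> x" "x \<le> 1" "\<bar>v\<bar> \<le> 1"
  defines "K \<equiv> int n ^ 4 * \<lceil>1 + T\<rceil>"
  shows "line_code T n x v \<in> UNIV \<times> {-K..K} \<times> {-K..K} \<times> {-K..K}"
proof -
  have n: "real n \<ge> 1" using assms by simp
  have T1: "1 \<le> \<lceil>1 + T\<rceil>" using \<open>T > 0\<close> by linarith
  have K: "int n ^ 4 \<le> K" "int n * \<lceil>1 + T\<rceil> \<le> K" "0 \<le> K" 
    using T1 assms(1) self_le_power[of "int n" 4] by (auto simp: K_def mult_right_mono)
  have n4: "real_of_int K \<ge> real n ^ 4" using K(1) by (metis of_int_le_iff of_int_of_nat_eq of_int_power)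
  have fl: "\<lfloor>z\<rfloor> \<in> {-K..K}" if "\<bar>z\<bar> \<le> of_int K" for z :: real
    using that by (auto simp: floor_le_iff le_floor_iff abs_le_iff)
  have nT: "real n * (1 + T) \<le> of_int K"
  proof -
    have "real n * (1 + T) \<le> real n * of_int \<lceil>1 + T\<rceil>" by (intro mult_left_mono) linarith+
    also have "\<dots> = of_int (int n * \<lceil>1 + T\<rceil>)" by simp
    also have "\<dots> \<le> of_int K" using K(2) by (simp only: of_int_le_iff)
    finally show ?thesis .
  qed
  have "real n * 1 \<le> real n * (1 + T)" using \<open>T > 0\<close> by (intro mult_left_mono) auto
  with nT have nK: "real n \<le> of_int K" by linarith
  have abx: "\<bar>real n ^ k * y\<bar> \<le> real n ^ k" if "\<bar>y\<bar> \<le> 1" for y k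
    using that mult_left_mono[of "\<bar>y\<bar>" 1 "real n ^ k"] by (simp add: abs_mult)
  show ?thesis
  proof (cases "\<bar>v\<bar> > 1 / real n ^ 2")
    case True
    then show ?thesis
      using fl[of "real n ^ 4 * x", OF order.trans[OF abx n4]] fl[of "real n ^ 4 * v", OF order.trans[OF abx n4]]
        K(3) assms(4-6) by (simp add: line_code_def)
  next
    case False
    define a where "a = \<lfloor>real n * x\<rfloor>"
    define b where "b = \<lfloor>real n * (x + T * v)\<rfloor>"
    define s where "s = (of_int (max a b) / real n - x) / v"
    have a: "a \<in> {-K..K}" unfolding a_def using order.trans[OF abx[of x 1]] nK assms(4,5) by (intro fl) simp
    have "\<bar>T * v\<bar> \<le> T * 1" using assms by (simp only: abs_mult) (intro mult_mono, auto)
    then have "\<bar>x + T * v\<bar> \<le> 1 + T" using assms by linarith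
    then have "real n * \<bar>x + T * v\<bar> \<le> real n * (1 + T)" by (intro mult_left_mono) auto
    then have b: "b \<in> {-K..K}" unfolding b_def using nT by (intro fl) (simp add: abs_mult)
    have s: "\<lfloor>real n * s / T\<rfloor> \<in> {-K..K}" if "a \<noteq> b"
    proof -
      note c = slow_line_crossing[OF assms(1-3), of v x, folded a_def b_def, folded s_def]
      have "0 \<le> s / T" "s / T \<le> 1" using c(1,2) that False \<open>T > 0\<close> by auto
      then show ?thesis using order.trans[of _ "real n" "of_int K", OF _ nK] abx[of "s / T" 1] by (intro fl) simp
    qed
    show ?thesis using False a b s K(3)
      by (auto simp: line_code_def Let_def a_def[symmetric] b_def[symmetric] s_def[symmetric])
  qed
qed

section \<open>Sojourn weights and a net of geodesics\<close>

lemma exists_large_component: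
  fixes v :: "real ^ 'd :: finite"
  assumes "norm v = 1" shows "\<exists>k. 1 / real CARD('d) \<le> \<bar>v $ k\<bar>"
proof (rule ccontr)
  assume "\<not> ?thesis"
  then have "(\<Sum>k\<in>UNIV. \<bar>v $ k\<bar>) < (\<Sum>k\<in>(UNIV :: 'd set). 1 / real CARD('d))"
    by (intro sum_strict_mono) (auto simp: not_le)
  with norm_le_l1_cart[of v] assms show False by simp
qed

text \<open>No cell is visited for long: some coordinate moves with speed at least \<open>1 / d\<close>, hence stays in a
given slab of width \<open>1 / n\<close> for a time at most \<open>d / n\<close>, and in time \<open>T\<close> it can meet at most
\<open>2 T + 5\<close> integer translates of that slab. This bound holds for every direction, including those of closed geodesics.\<close>

lemma visit_cell_le:
  fixes x v :: "real ^ 'd :: finite"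
  assumes "T > 0" "n \<ge> 1" "norm v = 1" "\<And>k. 0 \<le> x $ k" "\<And>k. x $ k \<le> 1"
  shows "visit T n x v {i} \<le> real CARD('d) * (2 * T + 5) / (real n * T)"
proof -
  obtain k where k: "1 / real CARD('d) \<le> \<bar>v $ k\<bar>" using exists_large_component[OF assms(3)] by blast
  have vk: "\<bar>v $ k\<bar> > 0" using k by (rule less_le_trans[rotated]) simp
  have v1: "\<bar>v $ k\<bar> \<le> 1" using component_le_norm_cart[of v k] assms(3) by simp
  have n: "real n > 0" using assms by simp
  define J where "J = {-\<lfloor>T + 2\<rfloor>..\<lfloor>T + 2\<rfloor>}"
  define r where "r = 1 / (2 * real n * \<bar>v $ k\<bar>)"
  \<comment> \<open>The time at which coordinate \<open>k\<close> is in the middle of the \<open>m\<close>-th translate of the slab.\<close>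
  define c where "c = (\<lambda>m::int. (of_int m + (real (i k) - 1 / 2) / real n - x $ k) / v $ k)"
  have sub: "{t \<in> {0..T}. cell_of n (x + t *\<^sub>R v) \<in> {i}} \<subseteq> (\<Union>m\<in>J. {c m - r .. c m + r})"
  proof
    fix t assume "t \<in> {t \<in> {0..T}. cell_of n (x + t *\<^sub>R v) \<in> {i}}"
    then have t: "0 \<le> t" "t \<le> T" and i: "i = cell_of n (x + t *\<^sub>R v)" by auto
    define y where "y = x $ k + t * v $ k"
    have "\<bar>t * v $ k\<bar> \<le> T * 1" using t v1 assms(1) by (simp only: abs_mult) (intro mult_mono, auto)
    then have y: "\<bar>y\<bar> \<le> 1 + T" using assms(4)[of k] assms(5)[of k] unfolding y_def by linarith
    have "abs_torus (x + t *\<^sub>R v) \<in> cell n i" using abs_torus_in_cell_of[OF assms(2)] i by simp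
    then obtain m :: int where m: "(real (i k) - 1) / real n \<le> y - m" "y - m \<le> real (i k) / real n"
      unfolding mem_cell_iff y_def by auto
    have ik: "1 \<le> i k" "i k \<le> n"
      using cell_of_in_cell_indices[OF assms(2), of "x + t *\<^sub>R v"] i by (auto simp: cell_indices_def)
    have "0 \<le> (real (i k) - 1) / real n" "real (i k) / real n \<le> 1" using ik n by auto
    with m y have "\<bar>of_int m\<bar> \<le> T + 2" by linarith
    then have "m \<in> J" unfolding J_def by simp linarith
    moreover have "\<bar>t - c m\<bar> \<le> r"
    proof -
      have "t - c m = (y - m - (real (i k) - 1 / 2) / real n) / v $ k"
        using vk by (simp add: c_def y_def field_simps)
      then have "\<bar>t - c m\<bar> = \<bar>y - m - (real (i k) - 1 / 2) / real n\<bar> / \<bar>v $ k\<bar>" by simp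
      also have "\<dots> \<le> (1 / (2 * real n)) / \<bar>v $ k\<bar>"
        using m by (intro divide_right_mono) (auto simp: abs_le_iff diff_divide_distrib)
      also have "\<dots> = r" by (simp add: r_def)
      finally show ?thesis .
    qed
    ultimately show "t \<in> (\<Union>m\<in>J. {c m - r .. c m + r})" by (intro UN_I[of m]) (auto simp: abs_le_iff)
  qed
  have "measure lborel {t \<in> {0..T}. cell_of n (x + t *\<^sub>R v) \<in> {i}} \<le> measure lborel (\<Union>m\<in>J. {c m - r .. c m + r})"
    using sub measurable_cell_of[of T n x v "{i}"]
    by (intro measure_mono_fmeasurable fmeasurable.finite_UN fmeasurable_Icc) (simp_all add: J_def)
  also have "\<dots> \<le> real (card J) * (2 * r)"
    by (intro measure_UN_Icc_le) (auto simp: J_def r_def)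
  also have "\<dots> \<le> (2 * T + 5) * (real CARD('d) / real n)"
  proof (intro mult_mono)
    have "0 \<le> \<lfloor>T + 2\<rfloor>" using assms(1) by simp
    then have "real (card J) = 2 * of_int \<lfloor>T + 2\<rfloor> + 1" by (simp add: J_def)
    then show "real (card J) \<le> 2 * T + 5" by linarith
    have "2 * r = (1 / \<bar>v $ k\<bar>) / real n" by (simp add: r_def)
    also have "\<dots> \<le> real CARD('d) / real n"
      using k vk by (intro divide_right_mono) (auto simp: field_simps)
    finally show "2 * r \<le> real CARD('d) / real n" .
  qed (use assms in \<open>auto simp: r_def\<close>)
  finally have "visit T n x v {i} \<le> (2 * T + 5) * (real CARD('d) / real n) / T"
    unfolding visit_def using assms(1) by (intro divide_right_mono) auto
  also have "\<dots> = real CARD('d) * (2 * T + 5) / (real n * T)" by simp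
  finally show ?thesis .
qed

lemma fmeasurable_visit: "{t \<in> {0..T}. cell_of n (x + t *\<^sub>R v) \<in> A} \<in> fmeasurable lborel"
  by (rule fmeasurable_subset_Icc[OF measurable_cell_of]) auto

lemma visit_nonneg: "T > 0 \<Longrightarrow> 0 \<le> visit T n x v A"
  by (simp add: visit_def)

lemma visit_UNIV:
  assumes "T > 0" shows "visit T n x v UNIV = 1"
proof -
  have "{t \<in> {0..T}. cell_of n (x + t *\<^sub>R v) \<in> UNIV} = {0..T}" by auto
  then have "visit T n x v UNIV = measure lborel {0..T} / T" by (simp only: visit_def)
  with assms show ?thesis by simp
qed

lemma visit_eq_sum:
  assumes "n \<ge> 1"
  shows "visit T n x v A = (\<Sum>i\<in>cell_indices n. visit T n x v {i} * of_bool (i \<in> A))"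
proof -
  have "{t \<in> {0..T}. cell_of n (x + t *\<^sub>R v) \<in> A} =
     (\<Union>i\<in>cell_indices n \<inter> A. {t \<in> {0..T}. cell_of n (x + t *\<^sub>R v) \<in> {i}})"
    using cell_of_in_cell_indices[OF assms] by auto
  also have "measure lborel \<dots> = (\<Sum>i\<in>cell_indices n \<inter> A. measure lborel {t \<in> {0..T}. cell_of n (x + t *\<^sub>R v) \<in> {i}})"
    by (intro measure_UNION' fmeasurable_visit) (auto simp: finite_cell_indices pairwise_def disjnt_def)
  finally have "visit T n x v A = (\<Sum>i\<in>cell_indices n \<inter> A. visit T n x v {i})"
    by (simp add: visit_def sum_divide_distrib)
  also have "\<dots> = (\<Sum>i\<in>cell_indices n. visit T n x v {i} * of_bool (i \<in> A))"
    by (rule sum.mono_neutral_cong_left) (auto simp: finite_cell_indices)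
  finally show ?thesis .
qed

definition geodesic_code :: "real \<Rightarrow> nat \<Rightarrow> (real ^ 'd) \<times> (real ^ 'd) \<Rightarrow> 'd :: finite \<Rightarrow> bool \<times> int \<times> int \<times> int"
  where "geodesic_code T n = (\<lambda>(x, v) k. line_code T n (x $ k) (v $ k))"

lemma geodesic_code_eq_imp_visit_le:
  fixes x v y u :: "real ^ 'd :: finite"
  assumes "n \<ge> 1" "T > 0" "real n > T" "norm v = 1" "\<And>k. 0 \<le> x $ k" "\<And>k. x $ k \<le> 1"
    and eq: "geodesic_code T n (x, v) = geodesic_code T n (y, u)"
  shows "visit T n x v A \<le> visit T n y u A + real CARD('d) * (10 * (1 + T)^2) / (real n * T)"
proof -
  define D where "D = (\<lambda>k. {t \<in> {0..T}. \<lfloor>real n * (x $ k + t * v $ k)\<rfloor> \<noteq> \<lfloor>real n * (y $ k + t * u $ k)\<rfloor>})"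
  have D: "D k \<in> sets borel" "D k \<in> fmeasurable lborel" for k
    unfolding D_def by (auto intro!: measurable_floor_disagreement fmeasurable_subset_Icc[where a=0 and b=T])
  have Dm: "measure lborel (D k) \<le> 10 * (1 + T)^2 / real n" for k
    unfolding D_def
  proof (rule line_code_eq_imp_close)
    show "\<bar>v $ k\<bar> \<le> 1" using component_le_norm_cart[of v k] assms(4) by simp
    show "line_code T n (x $ k) (v $ k) = line_code T n (y $ k) (u $ k)"
      using fun_cong[OF eq, of k] by (simp add: geodesic_code_def)
  qed (use assms in auto)
  have "{t \<in> {0..T}. cell_of n (x + t *\<^sub>R v) \<in> A} \<subseteq> {t \<in> {0..T}. cell_of n (y + t *\<^sub>R u) \<in> A} \<union> (\<Union>k\<in>UNIV. D k)"
  proof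
    fix t assume t: "t \<in> {t \<in> {0..T}. cell_of n (x + t *\<^sub>R v) \<in> A}"
    show "t \<in> {t \<in> {0..T}. cell_of n (y + t *\<^sub>R u) \<in> A} \<union> (\<Union>k\<in>UNIV. D k)"
    proof (cases "\<exists>k. t \<in> D k")
      case False
      then have "cell_of n (x + t *\<^sub>R v) = cell_of n (y + t *\<^sub>R u)"
        using t by (auto simp: D_def cell_of_def)
      then show ?thesis using t by auto
    qed auto
  qed
  then have "measure lborel {t \<in> {0..T}. cell_of n (x + t *\<^sub>R v) \<in> A} \<le>
      measure lborel ({t \<in> {0..T}. cell_of n (y + t *\<^sub>R u) \<in> A} \<union> (\<Union>k\<in>UNIV. D k))"
    by (rule measure_mono_fmeasurable)
      (use D in \<open>auto intro!: fmeasurable.Un fmeasurable.finite_UN fmeasurable_visit simp only: sets_lborel measurable_cell_of finite\<close>)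
  also have "\<dots> \<le> measure lborel {t \<in> {0..T}. cell_of n (y + t *\<^sub>R u) \<in> A} + measure lborel (\<Union>k\<in>UNIV. D k)"
    by (rule measure_Un_le) (use D in \<open>auto simp only: sets_lborel measurable_cell_of intro!: sets.finite_UN finite\<close>)
  also have "measure lborel (\<Union>k\<in>UNIV. D k) \<le> (\<Sum>k\<in>UNIV. measure lborel (D k))"
    using D by (intro measure_UNION_le) auto
  also have "\<dots> \<le> (\<Sum>k\<in>(UNIV :: 'd set). 10 * (1 + T)^2 / real n)" by (intro sum_mono Dm)
  finally have "measure lborel {t \<in> {0..T}. cell_of n (x + t *\<^sub>R v) \<in> A} \<le>
     measure lborel {t \<in> {0..T}. cell_of n (y + t *\<^sub>R u) \<in> A} + real CARD('d) * (10 * (1 + T)^2 / real n)"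
    by simp
  then have "visit T n x v A \<le> (measure lborel {t \<in> {0..T}. cell_of n (y + t *\<^sub>R u) \<in> A} + real CARD('d) * (10 * (1 + T)^2 / real n)) / T"
    unfolding visit_def using assms(2) by (intro divide_right_mono) auto
  then show ?thesis by (simp add: visit_def add_divide_distrib)
qed

text \<open>The parameters of all unit-speed geodesics, with the starting point chosen in the unit cube. The
finitely many codes below are available only for starting points in a bounded set.\<close>

definition pointed_lines :: "((real ^ 'd :: finite) \<times> (real ^ 'd)) set"
  where "pointed_lines = {(x, v). norm v = 1 \<and> (\<forall>k. 0 \<le> x $ k \<and> x $ k \<le> 1)}"

text \<open>One geodesic is chosen for each code that occurs. Taking actual geodesics, rather than the step
functions described by the codes, makes \<open>visit_cell_le\<close> available for the members of the net.\<close>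

lemma exists_polynomial_net:
  assumes "n \<ge> 1" "T > 0" "real n > T"
  defines "K \<equiv> n ^ 4 * nat \<lceil>1 + T\<rceil>"
  obtains R :: "((real ^ 'd :: finite) \<times> (real ^ 'd)) set"
  where "finite R" "R \<subseteq> pointed_lines" "card R \<le> (2 * (2 * K + 1) ^ 3) ^ CARD('d)"
    "\<And>x v. (x, v) \<in> pointed_lines \<Longrightarrow> \<exists>(y, u)\<in>R. \<forall>A. \<bar>visit T n x v A - visit T n y u A\<bar> \<le>
        real CARD('d) * (10 * (1 + T)^2) / (real n * T)"
proof -
  define code where "code = (geodesic_code T n :: (real ^ 'd) \<times> (real ^ 'd) \<Rightarrow> _)"
  define G where "G = (pointed_lines :: ((real ^ 'd) \<times> (real ^ 'd)) set)"
  define R where "R = inv_into G code ` code ` G"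
  have T1: "0 \<le> \<lceil>1 + T\<rceil>" using \<open>T > 0\<close> by linarith
  have K: "int K = int n ^ 4 * \<lceil>1 + T\<rceil>" using T1 by (simp add: K_def)
  define S where "S = (UNIV :: bool set) \<times> {-int K..int K} \<times> {-int K..int K} \<times> {-int K..int K}"
  have sub: "code ` G \<subseteq> PiE UNIV (\<lambda>_. S)"
  proof (intro image_subsetI PiE_I)
    fix p k assume "p \<in> G"
    obtain x v where p: "p = (x, v)" by (cases p)
    have "\<bar>v $ k\<bar> \<le> 1"
      using component_le_norm_cart[of v k] \<open>p \<in> G\<close> by (auto simp: p G_def pointed_lines_def)
    then have "line_code T n (x $ k) (v $ k) \<in> S"
      unfolding S_def K using \<open>p \<in> G\<close> assms by (intro line_code_range) (auto simp: p G_def pointed_lines_def)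
    then show "code p k \<in> S" by (simp add: code_def geodesic_code_def p)
  qed auto
  have "card {-int K..int K} = 2 * K + 1" by simp
  then have S: "finite S" "card S = 2 * (2 * K + 1) ^ 3"
    by (simp_all add: S_def card_cartesian_product power3_eq_cube)
  have "finite (PiE (UNIV :: 'd set) (\<lambda>_. S))" using S(1) by (intro finite_PiE) auto
  with sub have "finite (code ` G)" "card (code ` G) \<le> card (PiE (UNIV :: 'd set) (\<lambda>_. S))"
    by (auto intro: finite_subset card_mono)
  moreover have "card (PiE (UNIV :: 'd set) (\<lambda>_. S)) = (2 * (2 * K + 1) ^ 3) ^ CARD('d)"
    by (simp add: card_PiE S(2))
  ultimately have fin: "finite (code ` G)" and card: "card (code ` G) \<le> (2 * (2 * K + 1) ^ 3) ^ CARD('d)"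
    by simp_all
  have R: "finite R" "card R \<le> (2 * (2 * K + 1) ^ 3) ^ CARD('d)"
    unfolding R_def using fin order.trans[OF card_image_le[OF fin] card] by simp_all
  have RG: "R \<subseteq> G" unfolding R_def by (intro image_subsetI) (rule inv_into_into)
  show thesis
  proof (rule that[OF R(1) RG[unfolded G_def] R(2)])
    fix x v :: "real ^ 'd" assume xv: "(x, v) \<in> pointed_lines"
    define q where "q = inv_into G code (code (x, v))"
    obtain y u where q: "q = (y, u)" by (cases q)
    have "code (x, v) \<in> code ` G" using xv by (simp add: G_def)
    then have qR: "q \<in> R" and cq: "code q = code (x, v)"
      unfolding q_def R_def by (auto intro: f_inv_into_f)
    have yu: "(y, u) \<in> pointed_lines" using qR RG by (auto simp: q G_def)
    have "\<bar>visit T n x v A - visit T n y u A\<bar> \<le> real CARD('d) * (10 * (1 + T)^2) / (real n * T)" for A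
    proof -
      have "visit T n x v A \<le> visit T n y u A + real CARD('d) * (10 * (1 + T)^2) / (real n * T)"
        using assms xv cq by (intro geodesic_code_eq_imp_visit_le) (auto simp: pointed_lines_def code_def q)
      moreover have "visit T n y u A \<le> visit T n x v A + real CARD('d) * (10 * (1 + T)^2) / (real n * T)"
        using assms yu cq by (intro geodesic_code_eq_imp_visit_le) (auto simp: pointed_lines_def code_def q)
      ultimately show ?thesis by linarith
    qed
    with qR q show "\<exists>(y, u)\<in>R. \<forall>A. \<bar>visit T n x v A - visit T n y u A\<bar> \<le>
        real CARD('d) * (10 * (1 + T)^2) / (real n * T)" by blast
  qed
qed

section \<open>Concentration for weighted sums of Bernoulli variables\<close>

text \<open>Hoeffding's inequality, in which the sum of the squared weights is at most \<open>q\<close> times their sum,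
that is, at most \<open>q\<close>.\<close>

lemma weighted_bernoulli_deviation:
  fixes X :: "'i \<Rightarrow> 'a \<Rightarrow> bool" and p :: "'i \<Rightarrow> real"
  assumes "prob_space M" "finite I"
    and indep: "prob_space.indep_vars M (\<lambda>_. count_space UNIV) X I"
    and bern: "\<And>i. i \<in> I \<Longrightarrow> distr M (count_space UNIV) (X i) = measure_pmf (bernoulli_pmf \<epsilon>)"
    and "0 \<le> \<epsilon>" "\<epsilon> \<le> 1"
    and p: "\<And>i. i \<in> I \<Longrightarrow> 0 \<le> p i" "\<And>i. i \<in> I \<Longrightarrow> p i \<le> q" "(\<Sum>i\<in>I. p i) = 1"
    and "r \<ge> 0"
  shows "{w \<in> space M. \<bar>(\<Sum>i\<in>I. p i * of_bool (X i w)) - \<epsilon>\<bar> \<ge> r} \<in> sets M"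
    and "measure M {w \<in> space M. \<bar>(\<Sum>i\<in>I. p i * of_bool (X i w)) - \<epsilon>\<bar> \<ge> r} \<le> 2 * exp (- 2 * r\<^sup>2 / q)"
proof -
  interpret prob_space M by fact
  have X: "X i \<in> M \<rightarrow>\<^sub>M count_space UNIV" if "i \<in> I" for i
    using indep that unfolding indep_vars_def by blast
  have m: "(\<lambda>w. p i * of_bool (X i w)) \<in> borel_measurable M" if "i \<in> I" for i
    by (rule measurable_compose[OF X[OF that], of "\<lambda>b. p i * of_bool b"]) simp
  have iv: "indep_vars (\<lambda>_. borel) (\<lambda>i w. p i * of_bool (X i w)) I"
    by (rule indep_vars_compose2[OF indep, of "\<lambda>i b. p i * of_bool b"]) simp
  have E: "expectation (\<lambda>w. p i * of_bool (X i w)) = p i * \<epsilon>" if "i \<in> I" for i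
  proof -
    have "expectation (\<lambda>w. p i * of_bool (X i w)) = integral\<^sup>L (distr M (count_space UNIV) (X i)) (\<lambda>b. p i * of_bool b)"
      using X[OF that] by (simp add: integral_distr)
    also have "\<dots> = p i * \<epsilon>"
      unfolding bern[OF that] using assms(5,6) by simp
    finally show ?thesis .
  qed
  have "(\<Sum>i\<in>I. expectation (\<lambda>w. p i * of_bool (X i w))) = (\<Sum>i\<in>I. p i * \<epsilon>)"
    by (intro sum.cong refl E)
  also have "\<dots> = \<epsilon>" using p(3) by (simp add: sum_distrib_right[symmetric])
  finally have mean: "\<epsilon> = (\<Sum>i\<in>I. expectation (\<lambda>w. p i * of_bool (X i w)))" ..
  interpret H: Hoeffding_ineq M I "\<lambda>i w. p i * of_bool (X i w)" "\<lambda>_. 0" p \<epsilon>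
  proof unfold_locales
    show "\<epsilon> \<equiv> \<Sum>i\<in>I. expectation (\<lambda>w. p i * of_bool (X i w))"
      using mean by (rule eq_reflection)
  qed (use assms(2) iv p(1) in auto)
  have sq: "(\<Sum>i\<in>I. (p i - 0)\<^sup>2) \<le> q"
  proof -
    have "(\<Sum>i\<in>I. (p i - 0)\<^sup>2) \<le> (\<Sum>i\<in>I. q * p i)"
      using p by (intro sum_mono) (auto simp: power2_eq_square intro: mult_right_mono)
    also have "\<dots> = q" using p(3) by (simp add: sum_distrib_left[symmetric])
    finally show ?thesis .
  qed
  have pos: "(\<Sum>i\<in>I. (p i - 0)\<^sup>2) > 0"
  proof -
    obtain i where "i \<in> I" "p i \<noteq> 0" using p(3) by (metis sum.neutral zero_neq_one)
    then show ?thesis using assms(2) by (intro sum_pos2[of I i]) auto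
  qed
  show "{w \<in> space M. \<bar>(\<Sum>i\<in>I. p i * of_bool (X i w)) - \<epsilon>\<bar> \<ge> r} \<in> sets M"
    using m by measurable
  have "measure M {w \<in> space M. \<bar>(\<Sum>i\<in>I. p i * of_bool (X i w)) - \<epsilon>\<bar> \<ge> r} \<le>
     2 * exp (- 2 * r\<^sup>2 / (\<Sum>i\<in>I. (p i - 0)\<^sup>2))"
    by (rule H.Hoeffding_ineq_abs_ge[OF \<open>r \<ge> 0\<close> pos])
  also have "\<dots> \<le> 2 * exp (- 2 * r\<^sup>2 / q)"
    using sq pos by (auto intro!: divide_left_mono)
  finally show "measure M {w \<in> space M. \<bar>(\<Sum>i\<in>I. p i * of_bool (X i w)) - \<epsilon>\<bar> \<ge> r} \<le> 2 * exp (- 2 * r\<^sup>2 / q)" .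
qed

lemma power_times_exp_decay: "c > 0 \<Longrightarrow> (\<lambda>n. real n ^ p * exp (- c * real n)) \<longlonglongrightarrow> 0"
  by real_asymp

section \<open>The infimum over all geodesics\<close>

lemma geodesic_from_unit_cube:
  assumes "\<gamma> \<in> geodesics"
  obtains x v where "(x, v) \<in> pointed_lines" "\<gamma> = (\<lambda>t. abs_torus (x + t *\<^sub>R v))"
proof -
  obtain x v :: "real ^ 'a" where xv: "norm v = 1" "\<gamma> = (\<lambda>t. abs_torus (x + t *\<^sub>R v))"
    using assms by (auto simp: geodesics_def)
  define y :: "real ^ 'a" where "y = (\<chi> k. frac (x $ k))"
  have "abs_torus (x + t *\<^sub>R v) = abs_torus (y + t *\<^sub>R v)" for t
    by (simp add: abs_torus_eq_iff y_def frac_def)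
  moreover have "(y, v) \<in> pointed_lines"
    using xv(1) by (simp add: pointed_lines_def y_def frac_ge_0 less_imp_le[OF frac_lt_1])
  ultimately show thesis using that[of y v] xv(2) by simp
qed

lemma ell_ge:
  assumes "T > 0" "n \<ge> 1"
    and "\<And>x v. (x, v) \<in> pointed_lines \<Longrightarrow> b \<le> visit T n x v {i. c i}"
  shows "b \<le> ell T (checkerboard n c :: 'd :: finite torus set)"
  unfolding ell_def
proof (rule cINF_greatest)
  have "norm (axis undefined 1 :: real ^ 'd) = 1" by (simp add: norm_axis_1)
  then show "(geodesics :: (real \<Rightarrow> 'd torus) set) \<noteq> {}" unfolding geodesics_def by blast
  fix \<gamma> :: "real \<Rightarrow> 'd torus" assume "\<gamma> \<in> geodesics"
  then obtain x v where xv: "(x, v) \<in> pointed_lines" and \<gamma>: "\<gamma> = (\<lambda>t. abs_torus (x + t *\<^sub>R v))"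
    by (rule geodesic_from_unit_cube)
  show "b \<le> time_average T \<gamma> (checkerboard n c)"
    unfolding \<gamma> using assms(3)[OF xv] visit_le_time_average[OF assms(1,2)] by (rule order.trans)
qed

lemma countable_affine_Ints: "a \<noteq> 0 \<Longrightarrow> countable {t. b + a * t \<in> \<int>}" for a b :: real
proof -
  assume a: "a \<noteq> 0"
  have "{t. b + a * t \<in> \<int>} \<subseteq> range (\<lambda>j::int. (of_int j - b) / a)"
    using a by (auto simp: image_iff field_simps elim!: Ints_cases) 
  then show ?thesis by (rule countable_subset) auto
qed

text \<open>A line parallel to an axis, through the centres of the cells in all other coordinates. The upper
bound of the infimum needs a geodesic whose time average is not increased by the walls.\<close>

lemma exists_line_off_walls:
  assumes "n \<ge> 1"
  obtains x v :: "real ^ 'd :: finite"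
  where "(x, v) \<in> pointed_lines" "countable {t. \<exists>k. real n * (x + t *\<^sub>R v) $ k \<in> \<int>}"
proof -
  define x :: "real ^ 'd" where "x = (\<chi> k. 1 / (2 * real n))"
  define v :: "real ^ 'd" where "v = axis undefined 1"
  have half: "(1 / 2 :: real) \<notin> \<int>"
  proof
    assume "(1 / 2 :: real) \<in> \<int>"
    then obtain j :: int where "(1 / 2 :: real) = of_int j" by (rule Ints_cases)
    then have "1 = 2 * j" by linarith
    then show False by presburger
  qed
  have "{t. \<exists>k. real n * (x + t *\<^sub>R v) $ k \<in> \<int>} \<subseteq> {t. 1 / 2 + real n * t \<in> \<int>}"
  proof clarify
    fix t k assume "real n * (x + t *\<^sub>R v) $ k \<in> \<int>"
    then show "1 / 2 + real n * t \<in> \<int>"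
      using assms half by (auto simp: x_def v_def axis_def distrib_left split: if_splits)
  qed
  from countable_subset[OF this countable_affine_Ints]
  have "countable {t. \<exists>k. real n * (x + t *\<^sub>R v) $ k \<in> \<int>}" using assms by simp
  moreover have "(x, v) \<in> pointed_lines"
    using assms by (simp add: pointed_lines_def x_def v_def norm_axis_1)
  ultimately show thesis by (rule that[rotated])
qed

lemma ell_le:
  assumes "T > 0" "n \<ge> 1"
    and "\<And>x v. (x, v) \<in> pointed_lines \<Longrightarrow> visit T n x v {i. c i} \<le> b"
  shows "ell T (checkerboard n c :: 'd :: finite torus set) \<le> b"
proof -
  obtain x v :: "real ^ 'd" where xv: "(x, v) \<in> pointed_lines"
    "countable {t. \<exists>k. real n * (x + t *\<^sub>R v) $ k \<in> \<int>}"
    using exists_line_off_walls[OF assms(2)] by blast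
  have "ell T (checkerboard n c) \<le> time_average T (\<lambda>t. abs_torus (x + t *\<^sub>R v)) (checkerboard n c)"
    unfolding ell_def
  proof (rule cINF_lower)
    show "bdd_below ((\<lambda>\<gamma>. time_average T \<gamma> (checkerboard n c)) ` geodesics)"
    proof (rule bdd_belowI2)
      fix \<gamma> :: "real \<Rightarrow> 'd torus" assume "\<gamma> \<in> geodesics"
      then obtain y u where "\<gamma> = (\<lambda>t. abs_torus (y + t *\<^sub>R u))" by (auto simp: geodesics_def)
      then show "0 \<le> time_average T \<gamma> (checkerboard n c)"
        using assms(1) by (simp add: time_average_eq_measure)
    qed
    show "(\<lambda>t. abs_torus (x + t *\<^sub>R v)) \<in> geodesics"
      using xv(1) by (auto simp: geodesics_def pointed_lines_def)
  qed
  also have "\<dots> = visit T n x v {i. c i}" by (rule time_average_eq_visit[OF assms(2) xv(2)])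
  also have "\<dots> \<le> b" by (rule assms(3)[OF xv(1)])
  finally show ?thesis .
qed

text \<open>Outside a union of \<open>card R\<close> rare events, all sojourn proportions on the net are within \<open>\<delta> / 2\<close> of
\<open>\<epsilon>\<close>; those of all other geodesics are then within \<open>\<delta> / 2 + \<delta> / 4 < \<delta>\<close>, and so is their
infimum.\<close>

lemma deviation_bound:
  fixes X :: "('d :: finite \<Rightarrow> nat) \<Rightarrow> 'a \<Rightarrow> bool"
  assumes "T > 0" "n \<ge> 1" "real n > T" "0 \<le> \<epsilon>" "\<epsilon> \<le> 1" "\<delta> > 0"
    and "prob_space M"
    and indep: "prob_space.indep_vars M (\<lambda>_. count_space UNIV) X (cell_indices n)"
    and bern: "\<And>i. i \<in> cell_indices n \<Longrightarrow> distr M (count_space UNIV) (X i) = measure_pmf (bernoulli_pmf \<epsilon>)"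
    and fine: "real CARD('d) * (10 * (1 + T)^2) / (real n * T) \<le> \<delta> / 4"
  shows "\<P>(w in M. \<bar>ell T (checkerboard n (\<lambda>i. X i w)) - \<epsilon>\<bar> \<ge> \<delta>) \<le>
    (2 * (2 * (real n ^ 4 * real (nat \<lceil>1 + T\<rceil>)) + 1) ^ 3) ^ CARD('d) *
      (2 * exp (- (\<delta>\<^sup>2 * T / (2 * real CARD('d) * (2 * T + 5))) * real n))"
proof -
  interpret prob_space M by fact
  obtain R :: "((real ^ 'd) \<times> (real ^ 'd)) set" where R: "finite R" "R \<subseteq> pointed_lines"
    "card R \<le> (2 * (2 * (n ^ 4 * nat \<lceil>1 + T\<rceil>) + 1) ^ 3) ^ CARD('d)"
    "\<And>x v. (x, v) \<in> pointed_lines \<Longrightarrow> \<exists>(y, u)\<in>R. \<forall>A. \<bar>visit T n x v A - visit T n y u A\<bar> \<le>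
        real CARD('d) * (10 * (1 + T)^2) / (real n * T)"
    using exists_polynomial_net[OF assms(2,1,3)] by blast
  define q where "q = real CARD('d) * (2 * T + 5) / (real n * T)"
  define S where "S = (\<lambda>(x, v) w. \<Sum>i\<in>cell_indices n. visit T n x v {i} * of_bool (X i w))"
  define bad where "bad = (\<lambda>p. {w \<in> space M. \<bar>S p w - \<epsilon>\<bar> \<ge> \<delta> / 2})"
  have bad: "bad p \<in> sets M" "prob (bad p) \<le> 2 * exp (- 2 * (\<delta> / 2)\<^sup>2 / q)" if "p \<in> R" for p
  proof -
    obtain x v where p: "p = (x, v)" by (cases p)
    have xv: "norm v = 1" "\<And>k. 0 \<le> x $ k" "\<And>k. x $ k \<le> 1"
      using that R(2) by (auto simp: p pointed_lines_def)
    have one: "(\<Sum>i\<in>cell_indices n. visit T n x v {i}) = 1"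
      using visit_eq_sum[OF assms(2), of T x v UNIV] unfolding visit_UNIV[OF assms(1)] by simp
    have le_q: "visit T n x v {i} \<le> q" for i
      unfolding q_def by (rule visit_cell_le[OF assms(1,2) xv])
    have "0 \<le> \<delta> / 2" using \<open>\<delta> > 0\<close> by simp
    note dev = weighted_bernoulli_deviation[OF \<open>prob_space M\<close> finite_cell_indices indep bern assms(4,5)
        visit_nonneg[OF assms(1)] le_q one this]
    have "bad p = {w \<in> space M. \<bar>(\<Sum>i\<in>cell_indices n. visit T n x v {i} * of_bool (X i w)) - \<epsilon>\<bar> \<ge> \<delta> / 2}"
      by (simp add: bad_def S_def p)
    with dev show "bad p \<in> sets M" "prob (bad p) \<le> 2 * exp (- 2 * (\<delta> / 2)\<^sup>2 / q)"
      by simp_all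
  qed
  have sub: "{w \<in> space M. \<bar>ell T (checkerboard n (\<lambda>i. X i w)) - \<epsilon>\<bar> \<ge> \<delta>} \<subseteq> (\<Union>p\<in>R. bad p)"
  proof (rule subsetI, rule ccontr)
    fix w assume w: "w \<in> {w \<in> space M. \<bar>ell T (checkerboard n (\<lambda>i. X i w)) - \<epsilon>\<bar> \<ge> \<delta>}"
      and "w \<notin> (\<Union>p\<in>R. bad p)"
    then have good: "\<bar>S p w - \<epsilon>\<bar> < \<delta> / 2" if "p \<in> R" for p using that by (force simp: bad_def)
    have near: "\<bar>visit T n x v {i. X i w} - \<epsilon>\<bar> \<le> 3 * \<delta> / 4" if "(x, v) \<in> pointed_lines" for x v
    proof -
      from R(4)[OF that] obtain y u where yu: "(y, u) \<in> R"
        "\<bar>visit T n x v {i. X i w} - visit T n y u {i. X i w}\<bar> \<le>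
        real CARD('d) * (10 * (1 + T)^2) / (real n * T)" by blast
      have "S (y, u) w = visit T n y u {i. X i w}"
        using visit_eq_sum[OF assms(2), of T y u "{i. X i w}"] by (simp add: S_def)
      with good[OF yu(1)] yu(2) fine show ?thesis by linarith
    qed
    have "\<epsilon> - 3 * \<delta> / 4 \<le> ell T (checkerboard n (\<lambda>i. X i w))"
    proof (rule ell_ge[OF assms(1,2)])
      fix x v assume "(x, v) \<in> (pointed_lines :: ((real ^ 'd) \<times> _) set)"
      from near[OF this] show "\<epsilon> - 3 * \<delta> / 4 \<le> visit T n x v {i. X i w}" by linarith
    qed
    moreover have "ell T (checkerboard n (\<lambda>i. X i w)) \<le> \<epsilon> + 3 * \<delta> / 4"
    proof (rule ell_le[OF assms(1,2)])
      fix x v assume "(x, v) \<in> (pointed_lines :: ((real ^ 'd) \<times> _) set)"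
      from near[OF this] show "visit T n x v {i. X i w} \<le> \<epsilon> + 3 * \<delta> / 4" by linarith
    qed
    moreover have "\<bar>ell T (checkerboard n (\<lambda>i. X i w)) - \<epsilon>\<bar> \<ge> \<delta>" using w by simp
    ultimately show False using \<open>\<delta> > 0\<close> by linarith
  qed
  have "\<P>(w in M. \<bar>ell T (checkerboard n (\<lambda>i. X i w)) - \<epsilon>\<bar> \<ge> \<delta>) \<le> prob (\<Union>p\<in>R. bad p)"
    using sub bad(1) R(1) by (intro finite_measure_mono sets.finite_UN) auto
  also have "\<dots> \<le> (\<Sum>p\<in>R. prob (bad p))"
    using bad(1) R(1) by (intro finite_measure_subadditive_finite) auto
  also have "\<dots> \<le> (\<Sum>p\<in>R. 2 * exp (- 2 * (\<delta> / 2)\<^sup>2 / q))" by (intro sum_mono bad(2))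
  also have "\<dots> = real (card R) * (2 * exp (- 2 * (\<delta> / 2)\<^sup>2 / q))" by simp
  also have "\<dots> \<le> real ((2 * (2 * (n ^ 4 * nat \<lceil>1 + T\<rceil>) + 1) ^ 3) ^ CARD('d)) * (2 * exp (- 2 * (\<delta> / 2)\<^sup>2 / q))"
    using R(3) by (intro mult_right_mono) (simp_all only: of_nat_le_iff, simp)
  also have "- 2 * (\<delta> / 2)\<^sup>2 / q = - (\<delta>\<^sup>2 * T / (2 * real CARD('d) * (2 * T + 5))) * real n"
    using assms by (simp add: q_def field_simps power2_eq_square)
  finally show ?thesis by (simp only: of_nat_mult of_nat_power of_nat_add of_nat_numeral of_nat_1)
qed

text \<open>The size of the net is a polynomial in \<open>n\<close>, so the exponential of Hoeffding's inequality wins.\<close>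

lemma deviation_bound_decay:
  assumes "c > 0" "L \<ge> 0"
  shows "(\<lambda>n. (2 * (2 * (real n ^ 4 * L) + 1) ^ 3) ^ d * (2 * exp (- c * real n))) \<longlonglongrightarrow> 0"
proof (rule tendsto_sandwich[OF _ _ tendsto_const])
  define B where "B = 2 * (2 * L + 1) ^ 3"
  show "(\<lambda>n. (2 * B ^ d) * (real n ^ (12 * d) * exp (- c * real n))) \<longlonglongrightarrow> 0"
    using tendsto_mult_right_zero[OF power_times_exp_decay[OF assms(1)]] by blast
  show "\<forall>\<^sub>F n in sequentially. (2 * (2 * (real n ^ 4 * L) + 1) ^ 3) ^ d * (2 * exp (- c * real n)) \<le>
     (2 * B ^ d) * (real n ^ (12 * d) * exp (- c * real n))"
    using eventually_ge_at_top[of 1]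
  proof eventually_elim
    case (elim n)
    have "2 * (2 * (real n ^ 4 * L) + 1) ^ 3 \<le> 2 * (real n ^ 4 * (2 * L + 1)) ^ 3"
      using elim assms(2) by (intro mult_left_mono power_mono) (auto simp: distrib_left)
    also have "\<dots> = B * real n ^ 12" by (simp add: B_def power_mult_distrib flip: power_mult)
    finally have "(2 * (2 * (real n ^ 4 * L) + 1) ^ 3) ^ d \<le> (B * real n ^ 12) ^ d"
      using assms(2) by (intro power_mono) auto
    also have "\<dots> = B ^ d * real n ^ (12 * d)" by (simp add: power_mult_distrib power_mult)
    finally have "(2 * (2 * (real n ^ 4 * L) + 1) ^ 3) ^ d * (2 * exp (- c * real n)) \<le>
        B ^ d * real n ^ (12 * d) * (2 * exp (- c * real n))"
      by (rule mult_right_mono) simp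
    also have "\<dots> = (2 * B ^ d) * (real n ^ (12 * d) * exp (- c * real n))" by (simp only: mult_ac)
    finally show ?case .
  qed
  show "\<forall>\<^sub>F n in sequentially. 0 \<le> (2 * (2 * (real n ^ 4 * L) + 1) ^ 3) ^ d * (2 * exp (- c * real n))"
    using assms(2) by simp
qed


theorem theorem1p7:
  fixes T \<epsilon> :: real
    and \<Omega> :: "nat \<Rightarrow> 'a measure"
    and X :: "nat \<Rightarrow> ('d :: finite \<Rightarrow> nat) \<Rightarrow> 'a \<Rightarrow> bool"
  assumes "T > 0" and "0 \<le> \<epsilon>" and "\<epsilon> \<le> 1"
    and prob: "\<And>n. n \<ge> 1 \<Longrightarrow> prob_space (\<Omega> n)"
    and indep: "\<And>n. n \<ge> 1 \<Longrightarrow>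
      prob_space.indep_vars (\<Omega> n) (\<lambda>_. count_space UNIV) (X n) (cell_indices n)"
    and bernoulli: "\<And>n i. n \<ge> 1 \<Longrightarrow> i \<in> cell_indices n \<Longrightarrow>
      distr (\<Omega> n) (count_space UNIV) (X n i) = measure_pmf (bernoulli_pmf \<epsilon>)"
  shows "\<forall>\<delta>>0. (\<lambda>n. \<P>(w in \<Omega> n. \<bar>ell T (checkerboard n (\<lambda>i. X n i w)) - \<epsilon>\<bar> \<ge> \<delta>))
    \<longlonglongrightarrow> 0"
proof (intro allI impI)
  fix \<delta> :: real assume "\<delta> > 0"
  define c where "c = \<delta>\<^sup>2 * T / (2 * real CARD('d) * (2 * T + 5))"
  define C where "C = real CARD('d) * (10 * (1 + T)^2) / T"
  have "c > 0" using \<open>\<delta> > 0\<close> \<open>T > 0\<close> by (simp add: c_def)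
  have "(\<lambda>n. C / real n) \<longlonglongrightarrow> 0" by (rule lim_const_over_n)
  then have "\<forall>\<^sub>F n in sequentially. C / real n < \<delta> / 4"
    by (rule order_tendstoD) (use \<open>\<delta> > 0\<close> in simp)
  moreover have "\<forall>\<^sub>F n in sequentially. real n > T"
    using filterlim_real_sequentially by (simp add: filterlim_at_top_dense)
  ultimately have ev: "\<forall>\<^sub>F n in sequentially.
      \<P>(w in \<Omega> n. \<bar>ell T (checkerboard n (\<lambda>i. X n i w)) - \<epsilon>\<bar> \<ge> \<delta>) \<le>
      (2 * (2 * (real n ^ 4 * real (nat \<lceil>1 + T\<rceil>)) + 1) ^ 3) ^ CARD('d) * (2 * exp (- c * real n))"
    using eventually_ge_at_top[of 1]
  proof eventually_elim
    case (elim n)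
    have "real CARD('d) * (10 * (1 + T)^2) / (real n * T) \<le> \<delta> / 4"
      using elim(1) by (simp add: C_def mult.commute)
    from deviation_bound[OF \<open>T > 0\<close> elim(3,2) assms(2,3) \<open>\<delta> > 0\<close> prob[OF elim(3)]
        indep[OF elim(3)] bernoulli[OF elim(3)] this]
    show ?case by (simp only: c_def)
  qed
  show "(\<lambda>n. \<P>(w in \<Omega> n. \<bar>ell T (checkerboard n (\<lambda>i. X n i w)) - \<epsilon>\<bar> \<ge> \<delta>)) \<longlonglongrightarrow> 0"
    by (rule tendsto_sandwich[OF _ ev tendsto_const deviation_bound_decay[OF \<open>c > 0\<close> of_nat_0_le_iff]]) simp
qed

end
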